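(* Let $n\ge2$, let $A=B+iC\in\mathcal A_n$ (so $B,C\in\mathbb C^{n\times n}$ are Hermitian positive definite), and let $\omega\in[1,\infty)$ satisfy $\max\{\kappa(B),\kappa(C)\}\le\omega$. Then $$\frac1\omega\le\rho_n(A)\le\frac{2\sqrt2\,(1+\omega^2)}{(1+\omega)^2}.$$ The lower constant $1/\omega$ is sharp, even for diagonal Higham matrices: for every $n\ge2$ and every $1\le\omega<\infty$ there is a diagonal matrix $A=B+iC$ with $B,C\in\mathbb R^{n\times n}$ symmetric positive definite, $\max\{\kappa(B),\kappa(C)\}\le\omega$, and $\rho_n(A)=1/\omega$. In particular, $\rho_n(A)<2\sqrt2$ for every $A\in\mathcal A_n$.
   Context: $\mathcal A_n$ (accretive-dissipative, or generalized Higham, matrices of order $n$) is the set of matrices $B+iC$ with $B,C\in\mathbb C^{n\times n}$ Hermitian positive definite. A Higham matrix is a matrix $P+iQ$ with $P,Q\in\mathbb R^{n\times n}$ symmetric positive definite. For an invertible matrix $X$, $\kappa(X)=\|X\|\,\|X^{-1}\|$ with $\|\cdot\|$ the spectral norm. For $A=(a_{ij})\in\mathbb C^{n\times n}$ and $1\le k\le n-1$, $A^{(k)}=(a^{(k)}_{ij})\in\mathbb C^{(n-k)\times(n-k)}$ is the active matrix remaining after $k$ steps of Gaussian elimination without pivoting, i.e. the Schur complement $A_{22}-A_{21}A_{11}^{-1}A_{12}$ of the leading $k\times k$ principal block $A_{11}$ of $A$ (leading principal submatrices of matrices in $\mathcal A_n$ are nonsingular). The growth factor is (post-elimination convention, $k=0$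 is not included) $$\rho_n(A)=\frac{\max_{1\le k\le n-1}\max_{i,j}|a_{ij}^{(k)}|}{\max_{i,j}|a_{ij}|}.$$ *)

theory Defs
  imports
    "HOL-Analysis.Analysis"
    "Jordan_Normal_Form.Schur_Decomposition"
    "Jordan_Normal_Form.Gauss_Jordan_Elimination"
begin

(* Used for both complex and real matrices. Over the reals, conjugation is the identity, so
   this reads "symmetric positive definite"; over the complex numbers, 0 < z means that z is
   real and positive (the order of HOL-Library.Complex_Order), and (A *v v) .c v = v^* A v. *)
definition pos_def :: "nat \<Rightarrow> 'a :: conjugatable_ordered_field mat \<Rightarrow> bool" where
  "pos_def n A \<longleftrightarrow> A \<in> carrier_mat n n \<and> mat_adjoint A = A \<and>
     (\<forall>v \<in> carrier_vec n. v \<noteq> 0\<^sub>v n \<longrightarrow> 0 < (A *\<^sub>v v) \<bullet>c v)"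

definition accretive_dissipative :: "nat \<Rightarrow> complex mat set" where
  "accretive_dissipative n = {B + \<i> \<cdot>\<^sub>m C | B C. pos_def n B \<and> pos_def n C}"

definition l2norm_vec :: "complex vec \<Rightarrow> real" where
  "l2norm_vec v = sqrt (\<Sum>i<dim_vec v. (cmod (v $ i))\<^sup>2)"

definition spectral_norm :: "complex mat \<Rightarrow> real" where
  "spectral_norm A =
     (SUP v \<in> {v \<in> carrier_vec (dim_col A). l2norm_vec v = 1}. l2norm_vec (A *\<^sub>v v))"

(* Meaningful for invertible X only, since mat_inverse X is None otherwise. *)
definition cond_number :: "complex mat \<Rightarrow> real" where
  "cond_number X = spectral_norm X * spectral_norm (the (mat_inverse X))"

(* The active matrix after k steps of Gaussian elimination without pivoting. Meaningful only if
   the leading k x k block is invertible, since the inverse is taken by mat_inverse. *)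
definition active_mat :: "nat \<Rightarrow> complex mat \<Rightarrow> complex mat" where
  "active_mat k A = (case split_block A k k of (A11, A12, A21, A22) \<Rightarrow>
     A22 - A21 * the (mat_inverse A11) * A12)"

definition max_entry :: "complex mat \<Rightarrow> real" where
  "max_entry A = Max (cmod ` elements_mat A)"

(* Post-elimination convention: k = 0, i.e. A itself, is not included in the numerator. *)
definition growth_factor :: "complex mat \<Rightarrow> real" where
  "growth_factor A = (MAX k \<in> {1..dim_row A - 1}. max_entry (active_mat k A)) / max_entry A"

end

theory Submission
  imports Defs
begin

text \<open>
  Let \<open>A = B + \<i> C\<close>, and let \<open>S\<close> be the active matrix after \<open>k\<close> steps. For a vector \<open>e\<close> put
  \<open>E = (0, e)\<close>. Elimination finds a vector \<open>W = (w, 0)\<close> for which \<open>A (E - W) = (0, S e)\<close>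
  (\<open>eliminated_vector\<close>). Hence, with \<open>D = E - W\<close>, the quadratic form of \<open>S\<close> at \<open>e\<close> is that of \<open>A\<close> at
  \<open>D\<close>: its real part is the form of \<open>B\<close> at \<open>D\<close>, its imaginary part the form of \<open>C\<close> at \<open>D\<close>.

  Lower bound. The condition numbers place the spectra of \<open>B\<close> and \<open>C\<close> in intervals \<open>[m, \<omega> m]\<close> and
  \<open>[m', \<omega> m']\<close> (\<open>pos_def_spectrum_within\<close>). As \<open>D\<close> is no shorter than \<open>e\<close>, the diagonal entries of
  \<open>S\<close> have real part at least \<open>m\<close> and imaginary part at least \<open>m'\<close>, whereas all entries of \<open>A\<close> have
  modulus at most \<open>\<omega> \<bar>m + \<i> m'\<bar>\<close> (\<open>max_entry_le_of_spectrum\<close>).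

  Upper bound. It is convenient to measure a complex number in the right upper quadrant by the sum
  of its real and imaginary part. In this measure the elimination enlarges the form at most by the
  factor \<open>1 + \<theta>\<^sup>2\<close>, \<open>\<theta> = (\<omega> - 1) / (\<omega> + 1)\<close> (\<open>active_mat_form_bounds\<close>): the orthogonality of
  \<open>A D\<close> and \<open>W\<close> expresses the increase through the cross terms of \<open>W\<close> and \<open>E\<close>, and these are
  controlled by Wielandt's inequality, since \<open>W\<close> and \<open>E\<close> are orthogonal vectors (\<open>wielandt\<close>). An
  off-diagonal entry of \<open>S\<close> is bounded by the mean of the measures of two diagonal entries
  (\<open>entry_le_of_accretive_form\<close>), and on the diagonal of \<open>A\<close> the measure exceeds the modulus at most
  by the factor \<open>sqrt 2\<close>. The product \<open>sqrt 2 (1 + \<theta>\<^sup>2)\<close> is the stated constant, and it is below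
  \<open>2 sqrt 2\<close> since \<open>\<theta> < 1\<close>.

  Sharpness. For \<open>B = C = diag (\<omega>, 1, \<dots>, 1)\<close> the first step removes the only large entry.
\<close>

(* Below, \<open>v $ i\<close> is always an entry of a vector of variable dimension. *)
no_notation vec_nth (infixl \<open>$\<close> 90)

section \<open>The sesquilinear form of a matrix\<close>

definition sesq :: "complex mat \<Rightarrow> complex vec \<Rightarrow> complex vec \<Rightarrow> complex" where
  "sesq M x y = (M *\<^sub>v x) \<bullet>c y"

lemma sesq_add_left:
  assumes "M \<in> carrier_mat n n" "x \<in> carrier_vec n" "y \<in> carrier_vec n" "z \<in> carrier_vec n"
  shows "sesq M (x + y) z = sesq M x z + sesq M y z"
  unfolding sesq_def using assms
  by (subst mult_add_distrib_mat_vec[OF assms(1-3)], subst add_scalar_prod_distrib[of _ n]) auto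

lemma sesq_add_right:
  assumes "M \<in> carrier_mat n n" "x \<in> carrier_vec n" "y \<in> carrier_vec n" "z \<in> carrier_vec n"
  shows "sesq M x (y + z) = sesq M x y + sesq M x z"
  unfolding sesq_def using assms
  by (subst conjugate_add_vec[OF assms(3,4)], subst scalar_prod_add_distrib[of _ n]) auto

lemma sesq_smult_left:
  assumes "M \<in> carrier_mat n n" "x \<in> carrier_vec n" "y \<in> carrier_vec n"
  shows "sesq M (c \<cdot>\<^sub>v x) y = c * sesq M x y"
  unfolding sesq_def using assms
  by (subst mult_mat_vec[OF assms(1,2)], subst smult_scalar_prod_distrib[of _ n]) auto

lemma sesq_smult_right:
  assumes "M \<in> carrier_mat n n" "x \<in> carrier_vec n" "y \<in> carrier_vec n"
  shows "sesq M x (c \<cdot>\<^sub>v y) = cnj c * sesq M x y"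
  unfolding sesq_def using assms
  by (subst conjugate_smult_vec, subst scalar_prod_smult_distrib[of _ n]) auto

lemmas sesq_simps = sesq_add_left[where n=n] sesq_add_right[where n=n]
  sesq_smult_left[where n=n] sesq_smult_right[where n=n] for n

lemma sesq_mat_combination:
  assumes "B \<in> carrier_mat n n" "C \<in> carrier_mat n n" "x \<in> carrier_vec n" "y \<in> carrier_vec n"
  shows "sesq (B + c \<cdot>\<^sub>m C) x y = sesq B x y + c * sesq C x y"
proof -
  have "(c \<cdot>\<^sub>m C) *\<^sub>v x = c \<cdot>\<^sub>v (C *\<^sub>v x)"
    using assms by (intro eq_vecI) (auto simp: scalar_prod_def sum_distrib_left ac_simps)
  then have "(B + c \<cdot>\<^sub>m C) *\<^sub>v x = B *\<^sub>v x + c \<cdot>\<^sub>v (C *\<^sub>v x)"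
    using assms by (subst add_mult_distrib_mat_vec[of _ n n]) auto
  then show ?thesis
    unfolding sesq_def using assms
    by (simp add: add_scalar_prod_distrib[of _ n] smult_scalar_prod_distrib[of _ n])
qed

lemma sesq_unit_vec:
  assumes "M \<in> carrier_mat n n" "i < n" "j < n"
  shows "sesq M (unit_vec n j) (unit_vec n i) = M $$ (i, j)"
  using assms
  by (simp add: sesq_def scalar_prod_def if_distrib[of "\<lambda>t. _ * t"] if_distrib[of cnj] sum.delta cong: if_cong)

lemma sesq_one_mat:
  assumes "x \<in> carrier_vec n"
  shows "sesq (1\<^sub>m n) x y = x \<bullet>c y"
  using assms by (simp add: sesq_def)

lemma cscalar_prod_self: "v \<bullet>c v = complex_of_real ((l2norm_vec v)\<^sup>2)"
  by (simp add: scalar_prod_def l2norm_vec_def sum_nonneg complex_norm_square atLeast0LessThan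
      del: of_real_power)

lemma l2norm_vec_nonneg [simp]: "0 \<le> l2norm_vec v"
  by (simp add: l2norm_vec_def sum_nonneg)

lemma l2norm_vec_eq_0_iff:
  assumes "v \<in> carrier_vec n"
  shows "l2norm_vec v = 0 \<longleftrightarrow> v = 0\<^sub>v n"
  using cscalar_prod_self[of v] conjugate_square_eq_0_vec[OF assms] by auto

lemma l2norm_vec_smult: "l2norm_vec (c \<cdot>\<^sub>v v) = cmod c * l2norm_vec v"
  by (simp add: l2norm_vec_def norm_mult power_mult_distrib real_sqrt_mult flip: sum_distrib_left)

lemma l2norm_vec_unit_vec:
  assumes "i < n"
  shows "l2norm_vec (unit_vec n i) = 1"
  using assms by (simp add: l2norm_vec_def if_distrib[of cmod] if_distrib[of "\<lambda>t. t^2"] sum.delta cong: if_cong)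

lemma sesq_hermitian:
  assumes "M \<in> carrier_mat n n" "mat_adjoint M = M" "x \<in> carrier_vec n" "y \<in> carrier_vec n"
  shows "sesq M y x = cnj (sesq M x y)"
proof -
  have M: "M $$ (i, j) = cnj (M $$ (j, i))" if "i < n" "j < n" for i j
  proof -
    have "mat_adjoint M $$ (i, j) = cnj (M $$ (j, i))"
      using assms(1) that by (simp add: mat_adjoint_def mat_of_rows_def)
    then show ?thesis using assms(2) by simp
  qed
  have "sesq M y x = (\<Sum>i<n. \<Sum>j<n. M $$ (i, j) * y $ j * cnj (x $ i))"
    using assms by (simp add: sesq_def scalar_prod_def sum_distrib_right atLeast0LessThan)
  also have "\<dots> = (\<Sum>j<n. \<Sum>i<n. M $$ (i, j) * y $ j * cnj (x $ i))"
    by (rule sum.swap)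
  also have "\<dots> = (\<Sum>j<n. \<Sum>i<n. cnj (M $$ (j, i) * x $ i * cnj (y $ j)))"
    by (intro sum.cong refl, subst M) (auto simp: mult_ac)
  also have "\<dots> = cnj (sesq M x y)"
    using assms by (simp add: sesq_def scalar_prod_def sum_distrib_right sum_distrib_left atLeast0LessThan ac_simps)
  finally show ?thesis .
qed

lemma pos_def_sesq_self:
  assumes "pos_def n M" "x \<in> carrier_vec n"
  shows "sesq M x x = complex_of_real (Re (sesq M x x))" "0 \<le> Re (sesq M x x)"
    "x \<noteq> 0\<^sub>v n \<Longrightarrow> 0 < Re (sesq M x x)"
proof -
  have *: "0 < sesq M x x" if "x \<noteq> 0\<^sub>v n"
    using assms that by (auto simp: pos_def_def sesq_def)
  have **: "sesq M x x = 0" if "x = 0\<^sub>v n"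
    using assms that by (auto simp: pos_def_def sesq_def)
  show "sesq M x x = complex_of_real (Re (sesq M x x))"
    "0 \<le> Re (sesq M x x)" "x \<noteq> 0\<^sub>v n \<Longrightarrow> 0 < Re (sesq M x x)"
    using * ** by (cases "x = 0\<^sub>v n"; auto simp: less_complex_def complex_eq_iff)+
qed

section \<open>Wielandt's inequality\<close>

text \<open>All eigenvalues of the Hermitian matrix lie in \<open>[m, M]\<close>, expressed through Rayleigh
  quotients: the proofs only ever evaluate the form, never an eigenvector.\<close>
definition spectrum_within :: "nat \<Rightarrow> real \<Rightarrow> real \<Rightarrow> complex mat \<Rightarrow> bool" where
  "spectrum_within n m M B \<longleftrightarrow> pos_def n B \<and> 0 < m \<and>
     (\<forall>x \<in> carrier_vec n. m * (l2norm_vec x)\<^sup>2 \<le> Re (sesq B x x) \<and>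
                          Re (sesq B x x) \<le> M * (l2norm_vec x)\<^sup>2)"

text \<open>Wielandt's inequality says that \<open>\<bar>b(x, y)\<bar>\<^sup>2 \<le> \<theta>\<^sup>2 b(x, x) b(y, y)\<close> for orthogonal \<open>x\<close>, \<open>y\<close>;
  this is its form after the inequality of the arithmetic and geometric mean. The reason is that
  \<open>x + t y\<close> and \<open>x - t y\<close> have the same norm, so that the values of the form at these
  two vectors differ at most by the factor \<open>\<omega>\<close>. The choice \<open>t = \<theta>\<close> gives the claim.\<close>
lemma wielandt:
  fixes \<omega> :: real
  assumes B: "spectrum_within n m (\<omega> * m) B" and \<omega>: "1 \<le> \<omega>"
    and x: "x \<in> carrier_vec n" and y: "y \<in> carrier_vec n" and orth: "x \<bullet>c y = 0"
  defines "\<theta> \<equiv> (\<omega> - 1) / (\<omega> + 1)"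
  shows "2 * Re (sesq B x y) \<le> Re (sesq B x x) + \<theta>\<^sup>2 * Re (sesq B y y)"
proof -
  have Bc: "B \<in> carrier_mat n n" and her: "mat_adjoint B = B" and pd: "pos_def n B"
    using B by (auto simp: spectrum_within_def pos_def_def)
  let ?b = "\<lambda>x y. Re (sesq B x y)"
  have sym: "?b y x = ?b x y" using sesq_hermitian[OF Bc her x y] by simp
  have quad: "?b (x + of_real t \<cdot>\<^sub>v y) (x + of_real t \<cdot>\<^sub>v y) = ?b x x + 2 * t * ?b x y + t\<^sup>2 * ?b y y" for t
    using x y Bc sym by (simp add: sesq_simps[of _ n] power2_eq_square algebra_simps)
  have nrm: "(l2norm_vec (x + of_real t \<cdot>\<^sub>v y))\<^sup>2 = (l2norm_vec x)\<^sup>2 + t\<^sup>2 * (l2norm_vec y)\<^sup>2" for t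
  proof -
    let ?z = "x + complex_of_real t \<cdot>\<^sub>v y"
    have yx: "sesq (1\<^sub>m n) y x = cnj (sesq (1\<^sub>m n) x y)"
      using x y by (simp add: sesq_one_mat conjugate_vec_sprod_comm[of y n x]) 
        (metis complex_cnj_zero orth conjugate_complex_def conjugate_conjugate_sprod conjugate_vec_sprod_comm)
    have "complex_of_real ((l2norm_vec ?z)\<^sup>2) = sesq (1\<^sub>m n) ?z ?z"
      using x y by (simp add: sesq_one_mat cscalar_prod_self del: of_real_power)
    also have "\<dots> = sesq (1\<^sub>m n) x x + t\<^sup>2 * sesq (1\<^sub>m n) y y"
      using x y yx orth by (simp add: sesq_simps[of _ n]) (simp add: sesq_one_mat power2_eq_square)
    also have "\<dots> = complex_of_real ((l2norm_vec x)\<^sup>2 + t\<^sup>2 * (l2norm_vec y)\<^sup>2)"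
      using x y by (simp add: sesq_one_mat cscalar_prod_self)
    finally show ?thesis using of_real_eq_iff by blast
  qed
  have flip: "?b x x + 2 * t * ?b x y + t\<^sup>2 * ?b y y
      \<le> \<omega> * (?b x x - 2 * t * ?b x y + t\<^sup>2 * ?b y y)" for t
  proof -
    have c: "x + complex_of_real s \<cdot>\<^sub>v y \<in> carrier_vec n" for s using x y by auto
    have "?b x x + 2 * t * ?b x y + t\<^sup>2 * ?b y y
        \<le> \<omega> * m * ((l2norm_vec x)\<^sup>2 + t\<^sup>2 * (l2norm_vec y)\<^sup>2)"
      using B c[of t] unfolding spectrum_within_def by (metis quad nrm)
    also have "m * ((l2norm_vec x)\<^sup>2 + t\<^sup>2 * (l2norm_vec y)\<^sup>2) \<le> ?b x x - 2 * t * ?b x y + t\<^sup>2 * ?b y y"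
      using B c[of "-t"] quad[of "-t"] nrm[of "-t"] unfolding spectrum_within_def
      by (auto dest!: bspec[OF _ c[of "-t"]])
    then have "\<omega> * m * ((l2norm_vec x)\<^sup>2 + t\<^sup>2 * (l2norm_vec y)\<^sup>2)
       \<le> \<omega> * (?b x x - 2 * t * ?b x y + t\<^sup>2 * ?b y y)"
      using \<omega> by (simp add: mult.assoc)
    finally show ?thesis .
  qed
  have nn: "0 \<le> ?b x x" "0 \<le> ?b y y" using pos_def_sesq_self[OF pd] x y by auto
  show ?thesis
  proof (cases "\<omega> = 1")
    case True
    \<comment> \<open>Here \<open>\<theta> = 0\<close>, and \<open>t = \<theta>\<close> would carry no information.\<close>
    with flip[of 1] nn show ?thesis by (simp add: \<theta>_def)
  next
    case False
    then have pos: "\<theta> > 0" using \<omega> by (simp add: \<theta>_def)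
    have th: "\<omega> - 1 = \<theta> * (\<omega> + 1)" using \<omega> by (simp add: \<theta>_def)
    have "(\<omega> + 1) * (2 * \<theta> * ?b x y) \<le> (\<omega> - 1) * (?b x x + \<theta>\<^sup>2 * ?b y y)"
      using flip[of \<theta>] by (simp add: algebra_simps)
    then have "(\<theta> * (\<omega> + 1)) * (2 * ?b x y) \<le> (\<theta> * (\<omega> + 1)) * (?b x x + \<theta>\<^sup>2 * ?b y y)"
      unfolding th by (simp add: mult_ac)
    then show ?thesis using pos \<omega> by simp
  qed
qed

section \<open>Rayleigh quotients and the condition number\<close>

lemma mult_mat_zero_vec:
  "(A :: complex mat) \<in> carrier_mat nr nc \<Longrightarrow> A *\<^sub>v 0\<^sub>v nc = 0\<^sub>v nr"
  by (intro eq_vecI) auto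

lemma mat_inverse_of_injective:
  assumes A: "(A :: complex mat) \<in> carrier_mat n n"
    and inj: "\<And>v. v \<in> carrier_vec n \<Longrightarrow> A *\<^sub>v v = 0\<^sub>v n \<Longrightarrow> v = 0\<^sub>v n"
  obtains X where "mat_inverse A = Some X" "X \<in> carrier_mat n n" "A * X = 1\<^sub>m n" "X * A = 1\<^sub>m n"
proof -
  have "det A \<noteq> 0" using inj det_0_iff_vec_prod_zero_field[OF A] by auto
  then obtain X where "mat_inverse A = Some X"
    using mat_inverse(1)[OF A] det_non_zero_imp_unit[OF A] by (metis not_None_eq)
  with mat_inverse(2)[OF A this] that show ?thesis by blast
qed

lemma cauchy_schwarz_l2norm_vec:
  assumes "x \<in> carrier_vec n" "y \<in> carrier_vec n"
  shows "cmod (x \<bullet>c y) \<le> l2norm_vec x * l2norm_vec y"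
proof -
  have "cmod (x \<bullet>c y) \<le> (\<Sum>i<n. \<bar>cmod (x $ i)\<bar> * \<bar>cmod (y $ i)\<bar>)"
    using assms by (auto simp: scalar_prod_def atLeast0LessThan norm_mult intro!: sum_norm_le)
  also have "\<dots> \<le> L2_set (\<lambda>i. cmod (x $ i)) {..<n} * L2_set (\<lambda>i. cmod (y $ i)) {..<n}"
    by (rule L2_set_mult_ineq)
  finally show ?thesis using assms by (simp add: L2_set_def l2norm_vec_def)
qed

text \<open>The spectral norm is a supremum of reals, which bounds the single values only once the
  set is known to be bounded. The Cauchy--Schwarz inequality in each row gives the Frobenius norm
  as a bound.\<close>
lemma spectral_norm_bdd_above:
  "bdd_above ((\<lambda>v. l2norm_vec (M *\<^sub>v v)) ` {v \<in> carrier_vec (dim_col M). l2norm_vec v = 1})"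
proof (rule bdd_aboveI2)
  fix v assume v: "v \<in> {v \<in> carrier_vec (dim_col M). l2norm_vec v = 1}"
  have "cmod ((M *\<^sub>v v) $ i) \<le> l2norm_vec (conjugate (row M i))" if "i < dim_row M" for i
  proof -
    have "(M *\<^sub>v v) $ i = v \<bullet>c conjugate (row M i)"
      using that v by (simp add: comm_scalar_prod[of _ "dim_col M"])
    then show ?thesis
      using cauchy_schwarz_l2norm_vec[of v "dim_col M" "conjugate (row M i)"] v by simp
  qed
  then show "l2norm_vec (M *\<^sub>v v) \<le> sqrt (\<Sum>i<dim_row M. (l2norm_vec (conjugate (row M i)))\<^sup>2)"
    by (auto simp: l2norm_vec_def[of "M *\<^sub>v v"] simp del: index_mult_mat_vec intro!: sum_mono power_mono)
qed

lemma l2norm_vec_mult_mat_vec_le: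
  assumes M: "M \<in> carrier_mat n n" and v: "v \<in> carrier_vec n"
  shows "l2norm_vec (M *\<^sub>v v) \<le> spectral_norm M * l2norm_vec v"
proof (cases "v = 0\<^sub>v n")
  case True
  then have "M *\<^sub>v v = 0\<^sub>v n" using M by auto
  then show ?thesis using True l2norm_vec_eq_0_iff[of "0\<^sub>v n" n] by simp
next
  case False
  then have pos: "l2norm_vec v > 0"
    using l2norm_vec_eq_0_iff[OF v] by (simp add: order_less_le)
  let ?u = "complex_of_real (1 / l2norm_vec v) \<cdot>\<^sub>v v"
  have u: "?u \<in> {v \<in> carrier_vec (dim_col M). l2norm_vec v = 1}"
    using v M pos by (simp add: l2norm_vec_smult norm_divide)
  have "l2norm_vec (M *\<^sub>v ?u) \<le> spectral_norm M"
    unfolding spectral_norm_def by (rule cSUP_upper[OF u spectral_norm_bdd_above])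
  moreover have "M *\<^sub>v ?u = complex_of_real (1 / l2norm_vec v) \<cdot>\<^sub>v (M *\<^sub>v v)"
    by (rule mult_mat_vec[OF M v])
  ultimately show ?thesis using pos by (simp add: l2norm_vec_smult norm_divide field_simps)
qed

lemma spectral_norm_nonneg:
  assumes "M \<in> carrier_mat n n" "0 < n"
  shows "0 \<le> spectral_norm M"
  using l2norm_vec_mult_mat_vec_le[OF assms(1), of "unit_vec n 0"] assms(2)
    l2norm_vec_nonneg[of "M *\<^sub>v unit_vec n 0"]
  by (simp add: l2norm_vec_unit_vec del: l2norm_vec_nonneg)

lemma pos_def_injective:
  assumes "pos_def n (M :: complex mat)" "v \<in> carrier_vec n" "M *\<^sub>v v = 0\<^sub>v n"
  shows "v = 0\<^sub>v n"
  using pos_def_sesq_self(3)[OF assms(1) assms(2)] assms(2,3) by (auto simp: sesq_def)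

text \<open>The interval is \<open>[1 / \<parallel>inverse B\<parallel>, \<parallel>B\<parallel>]\<close>, enlarged on the right. For its lower end,
  with \<open>N = \<parallel>inverse B\<parallel>\<close> and \<open>y = inverse B v\<close>, both \<open>b(v, y)\<close> and \<open>b(y, v)\<close> are
  \<open>\<parallel>v\<parallel>\<^sup>2\<close> while \<open>b(y, y) \<le> N \<parallel>v\<parallel>\<^sup>2\<close>, so that the claim is \<open>b(v - y / N, v - y / N) \<ge> 0\<close> written
  out.\<close>
lemma pos_def_spectrum_within:
  assumes pd: "pos_def n B" and n: "0 < n" and cond: "cond_number B \<le> \<omega>"
  obtains m where "spectrum_within n m (\<omega> * m) B"
proof -
  have Bc: "B \<in> carrier_mat n n" and her: "mat_adjoint B = B"
    using pd by (auto simp: pos_def_def)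
  obtain X where X: "mat_inverse B = Some X" "X \<in> carrier_mat n n" "B * X = 1\<^sub>m n"
    using mat_inverse_of_injective[OF Bc pos_def_injective[OF pd]] by metis
  define N where "N = spectral_norm X"
  have key: "\<exists>y. y \<in> carrier_vec n \<and> Re (sesq B v y) = (l2norm_vec v)\<^sup>2 \<and> Re (sesq B y v) = (l2norm_vec v)\<^sup>2 
     \<and> Re (sesq B y y) \<le> N * (l2norm_vec v)\<^sup>2 \<and> B *\<^sub>v y = v"
    if v: "v \<in> carrier_vec n" for v
  proof (intro exI conjI)
    let ?y = "X *\<^sub>v v"
    show y: "?y \<in> carrier_vec n" using X v by auto
    show By: "B *\<^sub>v ?y = v" using Bc X v by (simp flip: assoc_mult_mat_vec[OF Bc X(2) v])
    then show yv: "Re (sesq B ?y v) = (l2norm_vec v)\<^sup>2"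
      by (simp add: sesq_def cscalar_prod_self del: of_real_power)
    then show "Re (sesq B v ?y) = (l2norm_vec v)\<^sup>2"
      using sesq_hermitian[OF Bc her v y] by simp
    have "Re (sesq B ?y ?y) \<le> cmod (v \<bullet>c ?y)"
      by (simp add: sesq_def By complex_Re_le_cmod)
    also have "\<dots> \<le> l2norm_vec v * l2norm_vec ?y"
      by (rule cauchy_schwarz_l2norm_vec[OF v y])
    also have "\<dots> \<le> l2norm_vec v * (N * l2norm_vec v)"
      unfolding N_def by (intro mult_left_mono l2norm_vec_mult_mat_vec_le[OF X(2) v]) simp
    finally show "Re (sesq B ?y ?y) \<le> N * (l2norm_vec v)\<^sup>2"
      by (simp add: power2_eq_square mult_ac)
  qed
  have N: "0 < N"
  proof -
    let ?v = "unit_vec n 0 :: complex vec"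
    obtain y where y: "y \<in> carrier_vec n" "Re (sesq B y y) \<le> N" "B *\<^sub>v y = ?v"
      using key[of ?v] n by (auto simp: l2norm_vec_unit_vec)
    have "y \<noteq> 0\<^sub>v n"
    proof
      assume "y = 0\<^sub>v n"
      then have "?v = 0\<^sub>v n" using y(3) mult_mat_zero_vec[OF Bc] by simp
      then show False using n by simp
    qed
    then show ?thesis using pos_def_sesq_self(3)[OF pd y(1)] y(2) by simp
  qed
  have normB: "spectral_norm B \<le> \<omega> * (1 / N)"
    using cond N X by (simp add: cond_number_def N_def[symmetric] field_simps)
  have "1 / N * (l2norm_vec v)\<^sup>2 \<le> Re (sesq B v v) \<and> Re (sesq B v v) \<le> \<omega> * (1 / N) * (l2norm_vec v)\<^sup>2"
    if v: "v \<in> carrier_vec n" for v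
  proof
    obtain y where y: "y \<in> carrier_vec n" "Re (sesq B v y) = (l2norm_vec v)\<^sup>2"
      "Re (sesq B y v) = (l2norm_vec v)\<^sup>2" "Re (sesq B y y) \<le> N * (l2norm_vec v)\<^sup>2"
      using key[OF v] by auto
    let ?t = "complex_of_real (- 1 / N)"
    have "0 \<le> Re (sesq B (v + ?t \<cdot>\<^sub>v y) (v + ?t \<cdot>\<^sub>v y))"
      using pos_def_sesq_self(2)[OF pd] v y by auto
    also have "\<dots> = Re (sesq B v v) - 2 / N * (l2norm_vec v)\<^sup>2 + Re (sesq B y y) / N\<^sup>2"
      using v y Bc by (simp add: sesq_simps[of _ n] power2_eq_square algebra_simps)
    also have "\<dots> \<le> Re (sesq B v v) - 2 / N * (l2norm_vec v)\<^sup>2 + N * (l2norm_vec v)\<^sup>2 / N\<^sup>2"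
      using y(4) by (simp add: divide_right_mono)
    also have "\<dots> = Re (sesq B v v) - 1 / N * (l2norm_vec v)\<^sup>2"
      using N by (simp add: power2_eq_square field_simps)
    finally show "1 / N * (l2norm_vec v)\<^sup>2 \<le> Re (sesq B v v)" by simp
    have "Re (sesq B v v) \<le> l2norm_vec (B *\<^sub>v v) * l2norm_vec v"
      unfolding sesq_def using cauchy_schwarz_l2norm_vec[of "B *\<^sub>v v" n v] v Bc complex_Re_le_cmod order_trans
      by (metis mult_mat_vec_carrier)
    also have "\<dots> \<le> (spectral_norm B * l2norm_vec v) * l2norm_vec v"
      by (intro mult_right_mono l2norm_vec_mult_mat_vec_le[OF Bc v]) simp
    also have "\<dots> = spectral_norm B * (l2norm_vec v)\<^sup>2" by (simp add: power2_eq_square)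
    also have "\<dots> \<le> \<omega> * (1 / N) * (l2norm_vec v)\<^sup>2" by (rule mult_right_mono[OF normB]) simp
    finally show "Re (sesq B v v) \<le> \<omega> * (1 / N) * (l2norm_vec v)\<^sup>2" .
  qed
  then show ?thesis using that[of "1 / N"] pd N by (auto simp: spectrum_within_def)
qed

section \<open>The form of a Schur complement\<close>

lemma active_mat_carrier:
  assumes "A \<in> carrier_mat n n" 
  shows "active_mat k A \<in> carrier_mat (n - k) (n - k)"
  using assms by (auto simp: active_mat_def split_block_def Let_def)

text \<open>Elimination as an orthogonality statement: with \<open>w = inverse A11 (A12 e)\<close> the first \<open>k\<close>
  entries of \<open>A (-w, e)\<close> vanish, and the others are those of the Schur complement applied to
  \<open>e\<close>. The hypothesis makes the leading block injective, hence invertible.\<close>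
lemma eliminated_vector:
  assumes A: "A \<in> carrier_mat n n" and k: "k \<le> n"
    and inj: "\<And>u. u \<in> carrier_vec k \<Longrightarrow> sesq A (u @\<^sub>v 0\<^sub>v (n - k)) (u @\<^sub>v 0\<^sub>v (n - k)) = 0 \<Longrightarrow> u = 0\<^sub>v k"
    and e: "e \<in> carrier_vec (n - k)"
  obtains w where "w \<in> carrier_vec k"
    "A *\<^sub>v ((- w) @\<^sub>v e) = 0\<^sub>v k @\<^sub>v (active_mat k A *\<^sub>v e)"
proof -
  obtain A11 A12 A21 A22 where sp: "split_block A k k = (A11, A12, A21, A22)"
    by (cases "split_block A k k")
  have dims: "dim_row A = k + (n - k)" "dim_col A = k + (n - k)" using A k by auto
  note b = split_block[OF sp dims]
  have mult: "A *\<^sub>v (u @\<^sub>v f) = (A11 *\<^sub>v u + A12 *\<^sub>v f) @\<^sub>v (A21 *\<^sub>v u + A22 *\<^sub>v f)"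
    if "u \<in> carrier_vec k" "f \<in> carrier_vec (n - k)" for u f
    unfolding b(5) by (rule four_block_mat_mult_vec[OF b(1-4) that])
  have "u = 0\<^sub>v k" if u: "u \<in> carrier_vec k" "A11 *\<^sub>v u = 0\<^sub>v k" for u
  proof (rule inj[OF u(1)])
    have "A *\<^sub>v (u @\<^sub>v 0\<^sub>v (n - k)) = 0\<^sub>v k @\<^sub>v (A21 *\<^sub>v u)"
      using b u by (subst mult) (auto simp: mult_mat_zero_vec)
    moreover have "conjugate (u @\<^sub>v 0\<^sub>v (n - k)) = conjugate u @\<^sub>v 0\<^sub>v (n - k)"
      using u by (intro eq_vecI) auto
    ultimately show "sesq A (u @\<^sub>v 0\<^sub>v (n - k)) (u @\<^sub>v 0\<^sub>v (n - k)) = 0"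
      unfolding sesq_def using u b by (simp add: scalar_prod_append[of _ k _ "n - k"])
  qed
  then obtain X where X: "mat_inverse A11 = Some X" "X \<in> carrier_mat k k" "A11 * X = 1\<^sub>m k"
    using mat_inverse_of_injective[OF b(1)] by metis
  define w where "w = X *\<^sub>v (A12 *\<^sub>v e)"
  have w: "w \<in> carrier_vec k" using X b e by (simp add: w_def)
  have A11w: "A11 *\<^sub>v w = A12 *\<^sub>v e"
    using X b e unfolding w_def by (simp flip: assoc_mult_mat_vec[OF b(1) X(2)])
  have S: "active_mat k A = A22 - A21 * X * A12"
    by (simp add: active_mat_def sp X)
  have "active_mat k A *\<^sub>v e = A22 *\<^sub>v e - A21 *\<^sub>v w"
    unfolding S w_def using b X e
    by (subst minus_mult_distrib_mat_vec[of _ "n - k" "n - k"]) 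
       (auto simp: assoc_mult_mat_vec[of _ "n - k" k _ "n-k"] assoc_mult_mat_vec[of _ "n - k" k _ "k"])
  moreover have "A *\<^sub>v ((- w) @\<^sub>v e) = (A11 *\<^sub>v (- w) + A12 *\<^sub>v e) @\<^sub>v (A21 *\<^sub>v (- w) + A22 *\<^sub>v e)"
    using w e by (intro mult) auto
  moreover have "A11 *\<^sub>v (- w) + A12 *\<^sub>v e = 0\<^sub>v k"
  proof -
    have "row A11 i \<bullet> w = row A12 i \<bullet> e" if "i < k" for i
      using arg_cong[OF A11w, of "\<lambda>v. v $ i"] that b by simp
    then show ?thesis using w b e by (intro eq_vecI) auto
  qed
  moreover have "A21 *\<^sub>v (- w) + A22 *\<^sub>v e = A22 *\<^sub>v e - A21 *\<^sub>v w"
    using w b e by (intro eq_vecI) auto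
  ultimately show ?thesis using that w by metis
qed

text \<open>The form of the Schur complement is the form of \<open>A\<close> itself at the corrected vector
  \<open>(-w, e)\<close>, because \<open>A (-w, e)\<close> is supported on the last entries and so does not see \<open>-w\<close>. For
  the same reason the form of \<open>A\<close> does not pair \<open>(-w, e)\<close> with \<open>(w, 0)\<close>.\<close>
lemma active_mat_form:
  assumes A: "A \<in> carrier_mat n n" and k: "k \<le> n"
    and inj: "\<And>u. u \<in> carrier_vec k \<Longrightarrow> sesq A (u @\<^sub>v 0\<^sub>v (n - k)) (u @\<^sub>v 0\<^sub>v (n - k)) = 0 \<Longrightarrow> u = 0\<^sub>v k"
    and e: "e \<in> carrier_vec (n - k)"
  obtains w where "w \<in> carrier_vec k"
    "sesq A ((- w) @\<^sub>v e) ((- w) @\<^sub>v e) = sesq (active_mat k A) e e"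
    "sesq A ((- w) @\<^sub>v e) (w @\<^sub>v 0\<^sub>v (n - k)) = 0"
proof -
  obtain w where w: "w \<in> carrier_vec k"
    "A *\<^sub>v ((- w) @\<^sub>v e) = 0\<^sub>v k @\<^sub>v (active_mat k A *\<^sub>v e)"
    using eliminated_vector[OF A k inj e] by blast
  have Se: "active_mat k A *\<^sub>v e \<in> carrier_vec (n - k)"
    using active_mat_carrier[OF A, of k] e by auto
  have conj: "conjugate (u @\<^sub>v f) = conjugate u @\<^sub>v conjugate f"
    if "u \<in> carrier_vec k" "f \<in> carrier_vec (n - k)" for u f :: "complex vec"
    using that by (intro eq_vecI) auto
  show ?thesis
  proof (rule that[OF w(1)])
    show "sesq A ((- w) @\<^sub>v e) ((- w) @\<^sub>v e) = sesq (active_mat k A) e e"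
      unfolding sesq_def w(2) using w(1) e Se
      by (simp add: conj scalar_prod_append[of _ k _ "n - k"])
    show "sesq A ((- w) @\<^sub>v e) (w @\<^sub>v 0\<^sub>v (n - k)) = 0"
      unfolding sesq_def w(2) using w(1) e Se
      by (simp add: conj scalar_prod_append[of _ k _ "n - k"])
  qed
qed

lemma l2norm_vec_append:
  "(l2norm_vec (u @\<^sub>v e))\<^sup>2 = (l2norm_vec u)\<^sup>2 + (l2norm_vec e)\<^sup>2"
proof -
  have conj: "conjugate (u @\<^sub>v e) = conjugate u @\<^sub>v conjugate e"
    by (intro eq_vecI) auto
  have "(u @\<^sub>v e) \<bullet>c (u @\<^sub>v e) = u \<bullet>c u + e \<bullet>c e"
    unfolding conj by (rule scalar_prod_append[of _ "dim_vec u" _ "dim_vec e"]) auto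
  then show ?thesis
    unfolding cscalar_prod_self by (metis of_real_add of_real_eq_iff)
qed

text \<open>Let \<open>b\<close>, \<open>c\<close> be the forms of \<open>B\<close>, \<open>C\<close>, and \<open>D = E - W\<close> with \<open>W = (w, 0)\<close>. Since \<open>b\<close> and
  \<open>c\<close> are real on the diagonal, \<open>b(D, D)\<close> and \<open>c(D, D)\<close> are the real and imaginary part of the
  form of the Schur complement. The lower bounds follow, because \<open>D\<close> is at least as long as
  \<open>e\<close>.

  For the upper bound put \<open>\<beta> = b(W, E)\<close> and \<open>\<gamma> = c(W, E)\<close>. The orthogonality of \<open>A D\<close> and \<open>W\<close> gives
  \<open>b(W, W) = Re \<beta> + Im \<gamma>\<close> and \<open>c(W, W) = Re \<gamma> - Im \<beta>\<close>; eliminating the real parts,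
  \<open>b(D, D) + c(D, D) = b(E, E) + c(E, E) - b(W, W) - c(W, W) + 2 Im \<gamma> - 2 Im \<beta>\<close>.
  As \<open>W\<close> and \<open>E\<close> have disjoint supports, Wielandt's inequality bounds the last two terms, and the
  terms in \<open>W\<close> cancel.\<close>
lemma active_mat_form_bounds:
  fixes \<omega> :: real
  assumes B: "spectrum_within n m\<^sub>B (\<omega> * m\<^sub>B) B" and C: "spectrum_within n m\<^sub>C (\<omega> * m\<^sub>C) C"
    and \<omega>: "1 \<le> \<omega>" and k: "k \<le> n" and e: "e \<in> carrier_vec (n - k)"
  defines "A \<equiv> B + \<i> \<cdot>\<^sub>m C" and "\<theta> \<equiv> (\<omega> - 1) / (\<omega> + 1)" and "E \<equiv> 0\<^sub>v k @\<^sub>v e"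
  shows "m\<^sub>B * (l2norm_vec e)\<^sup>2 \<le> Re (sesq (active_mat k A) e e)"
    and "m\<^sub>C * (l2norm_vec e)\<^sup>2 \<le> Im (sesq (active_mat k A) e e)"
    and "Re (sesq (active_mat k A) e e) + Im (sesq (active_mat k A) e e)
         \<le> (1 + \<theta>\<^sup>2) * (Re (sesq B E E) + Re (sesq C E E))"
proof -
  have Bpd: "pos_def n B" and Cpd: "pos_def n C"
    using B C by (auto simp: spectrum_within_def)
  have Bc: "B \<in> carrier_mat n n" "mat_adjoint B = B" and Cc: "C \<in> carrier_mat n n" "mat_adjoint C = C"
    using Bpd Cpd by (auto simp: pos_def_def)
  have A: "A \<in> carrier_mat n n" using Bc Cc by (simp add: A_def)
  have app: "u @\<^sub>v f \<in> carrier_vec n" if "u \<in> carrier_vec k" "f \<in> carrier_vec (n - k)" for u f :: "complex vec"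
    using append_carrier_vec[OF that] k by simp
  have sesqA: "sesq A x y = sesq B x y + \<i> * sesq C x y" if "x \<in> carrier_vec n" "y \<in> carrier_vec n" for x y
    unfolding A_def by (rule sesq_mat_combination[OF Bc(1) Cc(1) that])
  have inj: "u = 0\<^sub>v k" 
    if u: "u \<in> carrier_vec k" "sesq A (u @\<^sub>v 0\<^sub>v (n - k)) (u @\<^sub>v 0\<^sub>v (n - k)) = 0" for u
  proof -
    let ?x = "u @\<^sub>v 0\<^sub>v (n - k)"
    have x: "?x \<in> carrier_vec n" using app u by simp
    have "Re (sesq B ?x ?x) = 0"
      using u(2) sesqA[OF x x] pos_def_sesq_self(1)[OF Bpd x] pos_def_sesq_self(1)[OF Cpd x]
      by (auto simp: complex_eq_iff)
    then have "?x = 0\<^sub>v n" using pos_def_sesq_self(3)[OF Bpd x] by force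
    then have "?x $ i = 0" if "i < k" for i using that k by simp
    then show ?thesis using u(1) by (intro eq_vecI) auto
  qed
  obtain w where w: "w \<in> carrier_vec k"
    "sesq A ((- w) @\<^sub>v e) ((- w) @\<^sub>v e) = sesq (active_mat k A) e e"
    "sesq A ((- w) @\<^sub>v e) (w @\<^sub>v 0\<^sub>v (n - k)) = 0"
    using active_mat_form[OF A k inj e] by blast
  let ?D = "(- w) @\<^sub>v e" and ?W = "w @\<^sub>v 0\<^sub>v (n - k)"
  have D: "?D \<in> carrier_vec n" and W: "?W \<in> carrier_vec n" and E: "E \<in> carrier_vec n"
    using app w e unfolding E_def by auto
  have DE: "?D = E + (-1) \<cdot>\<^sub>v ?W"
    unfolding E_def using w e by (intro eq_vecI) auto
  have SD: "Re (sesq (active_mat k A) e e) = Re (sesq B ?D ?D)"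
    "Im (sesq (active_mat k A) e e) = Re (sesq C ?D ?D)"
    using w(2) sesqA[OF D D] pos_def_sesq_self(1)[OF Bpd D] pos_def_sesq_self(1)[OF Cpd D]
    by (auto simp: complex_eq_iff)
  have nD: "(l2norm_vec e)\<^sup>2 \<le> (l2norm_vec ?D)\<^sup>2"
    by (simp add: l2norm_vec_append)
  have "m\<^sub>B * (l2norm_vec e)\<^sup>2 \<le> m\<^sub>B * (l2norm_vec ?D)\<^sup>2"
    using B nD by (auto simp: spectrum_within_def)
  also have "\<dots> \<le> Re (sesq B ?D ?D)" using B D by (auto simp: spectrum_within_def)
  finally show "m\<^sub>B * (l2norm_vec e)\<^sup>2 \<le> Re (sesq (active_mat k A) e e)" by (simp add: SD)
  have "m\<^sub>C * (l2norm_vec e)\<^sup>2 \<le> m\<^sub>C * (l2norm_vec ?D)\<^sup>2"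
    using C nD by (auto simp: spectrum_within_def)
  also have "\<dots> \<le> Re (sesq C ?D ?D)" using C D by (auto simp: spectrum_within_def)
  finally show "m\<^sub>C * (l2norm_vec e)\<^sup>2 \<le> Im (sesq (active_mat k A) e e)" by (simp add: SD)
  define \<beta> \<gamma> where "\<beta> = sesq B ?W E" and "\<gamma> = sesq C ?W E"
  have EW: "sesq B E ?W = cnj \<beta>" "sesq C E ?W = cnj \<gamma>"
    unfolding \<beta>_def \<gamma>_def by (rule sesq_hermitian[OF Bc W E], rule sesq_hermitian[OF Cc W E])
  have expand: "Re (sesq B ?D ?D) = Re (sesq B E E) - 2 * Re \<beta> + Re (sesq B ?W ?W)"
    "Re (sesq C ?D ?D) = Re (sesq C E E) - 2 * Re \<gamma> + Re (sesq C ?W ?W)"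
    unfolding DE using Bc(1) Cc(1) E W EW
    by (simp_all add: sesq_simps[of _ n] flip: \<beta>_def \<gamma>_def)
  have "sesq A E ?W = sesq A ?W ?W"
    using w(3) A E W unfolding DE by (simp add: sesq_simps[of _ n])
  then have "cnj \<beta> + \<i> * cnj \<gamma> = sesq B ?W ?W + \<i> * sesq C ?W ?W"
    by (simp add: sesqA E W EW)
  then have proj: "Re (sesq B ?W ?W) = Re \<beta> + Im \<gamma>" "Re (sesq C ?W ?W) = Re \<gamma> - Im \<beta>"
    using pos_def_sesq_self(1)[OF Bpd W] pos_def_sesq_self(1)[OF Cpd W]
    by (auto simp: complex_eq_iff)
  have orth: "(c \<cdot>\<^sub>v ?W) \<bullet>c E = 0" for c
  proof -
    have "conjugate E = 0\<^sub>v k @\<^sub>v conjugate e" unfolding E_def by (intro eq_vecI) auto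
    then have "?W \<bullet>c E = 0"
      using w(1) e by (simp add: scalar_prod_append[of _ k _ "n - k"])
    then show ?thesis using W E by simp
  qed
  \<comment> \<open>Rotating \<open>W\<close> by a unit \<open>c\<close> turns the imaginary parts of \<open>\<beta>\<close> and \<open>\<gamma>\<close> into real parts.\<close>
  have rot: "2 * Re (c * sesq M ?W E) \<le> Re (sesq M ?W ?W) + \<theta>\<^sup>2 * Re (sesq M E E)"
    if M: "spectrum_within n m (\<omega> * m) M" and c: "cmod c = 1" for c m M
  proof -
    have Mc: "M \<in> carrier_mat n n" using M by (auto simp: spectrum_within_def pos_def_def)
    have cW: "c \<cdot>\<^sub>v ?W \<in> carrier_vec n" using W by simp
    have "c * cnj c = 1" "cnj c * c = 1" using c by (simp_all add: complex_norm_square[symmetric] mult.commute)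
    then have "sesq M (c \<cdot>\<^sub>v ?W) (c \<cdot>\<^sub>v ?W) = sesq M ?W ?W"
      using Mc W by (simp add: sesq_simps[of _ n] flip: mult.assoc)
    moreover have "sesq M (c \<cdot>\<^sub>v ?W) E = c * sesq M ?W E"
      by (rule sesq_smult_left[OF Mc W E])
    ultimately show ?thesis
      using wielandt[OF M \<omega> cW E orth] unfolding \<theta>_def by simp
  qed
  have "- 2 * Im \<beta> \<le> Re (sesq B ?W ?W) + \<theta>\<^sup>2 * Re (sesq B E E)"
    using rot[OF B, of \<i>] by (simp add: \<beta>_def)
  moreover have "2 * Im \<gamma> \<le> Re (sesq C ?W ?W) + \<theta>\<^sup>2 * Re (sesq C E E)"
    using rot[OF C, of "- \<i>"] by (simp add: \<gamma>_def)
  ultimately show "Re (sesq (active_mat k A) e e) + Im (sesq (active_mat k A) e e)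
         \<le> (1 + \<theta>\<^sup>2) * (Re (sesq B E E) + Re (sesq C E E))"
    using expand proj SD by (simp add: algebra_simps)
qed

section \<open>Bounding entries by quadratic forms\<close>

lemma unit_multiplier:
  assumes "cmod c = 1"
  obtains \<xi> where "cmod \<xi> = 1" "cnj \<xi> * z = c * complex_of_real (cmod z)"
proof (cases "z = 0")
  case True
  with that[of 1] show ?thesis by simp
next
  case False
  let ?\<xi> = "cnj c * z / of_real (cmod z)"
  have "cnj ?\<xi> * z = c * (z * cnj z) / of_real (cmod z)" by simp
  also have "\<dots> = c * of_real (cmod z)"
    using False by (simp add: complex_norm_square[symmetric] power2_eq_square)
  finally show ?thesis using that[of ?\<xi>] False assms by (simp add: norm_mult norm_divide)
qed

lemma sesq_unit_vec_sum:
  assumes M: "M \<in> carrier_mat n n" and ij: "i < n" "j < n" and \<xi>: "cmod \<xi> = 1"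
  defines "x \<equiv> unit_vec n j + \<xi> \<cdot>\<^sub>v unit_vec n i"
  shows "sesq M x x = M $$ (i, i) + M $$ (j, j) + (cnj \<xi> * M $$ (i, j) + \<xi> * M $$ (j, i))"
proof -
  have "\<xi> * cnj \<xi> = 1" using \<xi> by (simp add: complex_norm_square[symmetric])
  then show ?thesis
    unfolding x_def using M ij
    by (simp add: sesq_simps[of _ n] sesq_unit_vec algebra_simps)
qed

text \<open>Write \<open>M = H + \<i> K\<close> with \<open>H\<close>, \<open>K\<close> Hermitian and positive semidefinite. Then
  \<open>2 \<bar>H i j\<bar> \<le> H i i + H j j\<close>, likewise for \<open>K\<close>, and the triangle inequality adds the two. Bounding
  the off-diagonal entries by the sum of real and imaginary part of the diagonal, instead of by its
  modulus, postpones the only use of \<open>Re z + Im z \<le> sqrt 2 \<bar>z\<bar>\<close> to the diagonal of the original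
  matrix.\<close>
lemma entry_le_of_accretive_form:
  assumes M: "M \<in> carrier_mat n n"
    and nn: "\<And>x. x \<in> carrier_vec n \<Longrightarrow> 0 \<le> Re (sesq M x x) \<and> 0 \<le> Im (sesq M x x)"
    and ij: "i < n" "j < n"
  shows "2 * cmod (M $$ (i, j)) \<le> Re (M $$ (i, i)) + Im (M $$ (i, i)) + Re (M $$ (j, j)) + Im (M $$ (j, j))"
proof -
  let ?a = "M $$ (i, j)" and ?d = "M $$ (j, i)" and ?p = "M $$ (i, i) + M $$ (j, j)"
  have q: "0 \<le> Re (?p + (cnj \<xi> * ?a + \<xi> * ?d)) \<and> 0 \<le> Im (?p + (cnj \<xi> * ?a + \<xi> * ?d))"
    if "cmod \<xi> = 1" for \<xi>
    using nn[of "unit_vec n j + \<xi> \<cdot>\<^sub>v unit_vec n i"] sesq_unit_vec_sum[OF M ij that] by simp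
  obtain \<xi> where \<xi>: "cmod \<xi> = 1" "cnj \<xi> * (?a + cnj ?d) = - 1 * of_real (cmod (?a + cnj ?d))"
    using unit_multiplier[of "-1" "?a + cnj ?d"] by auto
  have "Re (cnj \<xi> * ?a + \<xi> * ?d) = Re (cnj \<xi> * (?a + cnj ?d))" by (simp add: algebra_simps)
  then have 1: "cmod (?a + cnj ?d) \<le> Re ?p" using q[OF \<xi>(1)] \<xi>(2) by simp
  obtain \<zeta> where \<zeta>: "cmod \<zeta> = 1" "cnj \<zeta> * (?a - cnj ?d) = - \<i> * of_real (cmod (?a - cnj ?d))"
    using unit_multiplier[of "-\<i>" "?a - cnj ?d"] by auto
  have "Im (cnj \<zeta> * ?a + \<zeta> * ?d) = Im (cnj \<zeta> * (?a - cnj ?d))" by (simp add: algebra_simps)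
  then have 2: "cmod (?a - cnj ?d) \<le> Im ?p" using q[OF \<zeta>(1)] \<zeta>(2) by simp
  have "2 * cmod ?a = cmod ((?a + cnj ?d) + (?a - cnj ?d))" by (simp add: norm_mult)
  also have "\<dots> \<le> cmod (?a + cnj ?d) + cmod (?a - cnj ?d)" by (rule norm_triangle_ineq)
  finally show ?thesis using 1 2 by simp
qed

text \<open>For the off-diagonal entries: with a suitable unit \<open>\<xi>\<close>, and \<open>u\<close> the standard basis, the
  values of the form at \<open>u j + \<xi> u i\<close> and \<open>u j - \<xi> u i\<close> differ by \<open>4 \<bar>B i j\<bar>\<close>; the first is at most \<open>2 M\<close>, the second is nonnegative.\<close>
lemma spectrum_within_entries:
  assumes B: "spectrum_within n m M B" and ij: "i < n" "j < n"
  shows "B $$ (i, i) = of_real (Re (B $$ (i, i)))" "m \<le> Re (B $$ (i, i))" "Re (B $$ (i, i)) \<le> M"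
    and "i \<noteq> j \<Longrightarrow> 2 * cmod (B $$ (i, j)) \<le> M"
proof -
  have pd: "pos_def n B" and Bc: "B \<in> carrier_mat n n" and her: "mat_adjoint B = B"
    and bnd: "\<And>x. x \<in> carrier_vec n \<Longrightarrow> Re (sesq B x x) \<le> M * (l2norm_vec x)\<^sup>2"
    and bnd': "\<And>x. x \<in> carrier_vec n \<Longrightarrow> m * (l2norm_vec x)\<^sup>2 \<le> Re (sesq B x x)"
    using B by (auto simp: spectrum_within_def pos_def_def)
  have u: "sesq B (unit_vec n i) (unit_vec n i) = B $$ (i, i)"
    using Bc ij by (simp add: sesq_unit_vec)
  show "B $$ (i, i) = of_real (Re (B $$ (i, i)))"
    using pos_def_sesq_self(1)[OF pd, of "unit_vec n i"] u by simp
  show "m \<le> Re (B $$ (i, i))" "Re (B $$ (i, i)) \<le> M"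
    using bnd[of "unit_vec n i"] bnd'[of "unit_vec n i"] u ij by (simp_all add: l2norm_vec_unit_vec)
  assume ne: "i \<noteq> j"
  obtain \<xi> where \<xi>: "cmod \<xi> = 1" "cnj \<xi> * B $$ (i, j) = 1 * of_real (cmod (B $$ (i, j)))"
    using unit_multiplier[of 1 "B $$ (i, j)"] by auto
  have ji: "B $$ (j, i) = cnj (B $$ (i, j))"
    using sesq_hermitian[OF Bc her, of "unit_vec n j" "unit_vec n i"] Bc ij
    by (simp add: sesq_unit_vec)
  have "cnj (cnj \<xi> * B $$ (i, j)) = of_real (cmod (B $$ (i, j)))" using \<xi>(2) by simp
  then have \<xi>': "\<xi> * B $$ (j, i) = of_real (cmod (B $$ (i, j)))" by (simp add: ji)
  let ?x = "\<lambda>\<xi>. unit_vec n j + \<xi> \<cdot>\<^sub>v unit_vec n i :: complex vec"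
  have "0 \<le> Re (sesq B (?x (- \<xi>)) (?x (- \<xi>)))" by (rule pos_def_sesq_self(2)[OF pd]) simp
  then have 1: "0 \<le> Re (B $$ (i, i) + B $$ (j, j)) - 2 * cmod (B $$ (i, j))"
    using \<xi> \<xi>' by (subst (asm) sesq_unit_vec_sum[OF Bc ij]) auto
  have "(l2norm_vec (?x \<xi>))\<^sup>2 = 2"
  proof -
    have "complex_of_real ((l2norm_vec (?x \<xi>))\<^sup>2) = sesq (1\<^sub>m n) (?x \<xi>) (?x \<xi>)"
      by (simp add: sesq_one_mat cscalar_prod_self del: of_real_power)
    also have "\<dots> = 2" using ij ne by (subst sesq_unit_vec_sum[OF _ ij \<xi>(1)]) auto
    finally show ?thesis by (metis of_real_eq_iff of_real_numeral)
  qed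
  then have 2: "Re (B $$ (i, i) + B $$ (j, j)) + 2 * cmod (B $$ (i, j)) \<le> 2 * M"
    using bnd[of "?x \<xi>"] \<xi> \<xi>' by (simp add: sesq_unit_vec_sum[OF Bc ij])
  show "2 * cmod (B $$ (i, j)) \<le> M" using 1 2 by simp
qed

section \<open>The growth factor\<close>

lemma cmod_le_max_entry:
  assumes "A \<in> carrier_mat nr nc" "i < nr" "j < nc"
  shows "cmod (A $$ (i, j)) \<le> max_entry A"
  unfolding max_entry_def using assms
  by (intro Max_ge imageI elements_matI) (auto simp: elements_mat_def)

lemma max_entry_le:
  assumes A: "A \<in> carrier_mat nr nc" and pos: "0 < nr" "0 < nc"
    and le: "\<And>i j. i < nr \<Longrightarrow> j < nc \<Longrightarrow> cmod (A $$ (i, j)) \<le> c"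
  shows "max_entry A \<le> c"
proof -
  have "A $$ (0, 0) \<in> elements_mat A" using A pos by auto
  then have "elements_mat A \<noteq> {}" by auto
  moreover have "finite (elements_mat A)" by (simp add: elements_mat_def)
  ultimately show ?thesis
    unfolding max_entry_def using A le by (subst Max_le_iff) auto
qed

lemma growth_factor_le:
  assumes A: "A \<in> carrier_mat n n" and n: "2 \<le> n" and pos: "0 < max_entry A"
    and le: "\<And>k i j. 1 \<le> k \<Longrightarrow> k < n \<Longrightarrow> i < n - k \<Longrightarrow> j < n - k
               \<Longrightarrow> cmod (active_mat k A $$ (i, j)) \<le> c * max_entry A"
  shows "growth_factor A \<le> c"
proof -
  have "max_entry (active_mat k A) \<le> c * max_entry A" if "k \<in> {1..n - 1}" for k
    using that n by (intro max_entry_le[OF active_mat_carrier[OF A]] le) auto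
  then have "(MAX k \<in> {1..n - 1}. max_entry (active_mat k A)) \<le> c * max_entry A"
    using n by (subst Max_le_iff) auto
  then show ?thesis using A pos by (simp add: growth_factor_def field_simps)
qed

lemma growth_factor_ge:
  assumes A: "A \<in> carrier_mat n n" and k: "1 \<le> k" "k < n" "i < n - k" "j < n - k"
    and pos: "0 < max_entry A"
  shows "cmod (active_mat k A $$ (i, j)) / max_entry A \<le> growth_factor A"
proof -
  have "cmod (active_mat k A $$ (i, j)) \<le> max_entry (active_mat k A)"
    using k by (intro cmod_le_max_entry[OF active_mat_carrier[OF A]]) auto
  also have "\<dots> \<le> (MAX k \<in> {1..n - 1}. max_entry (active_mat k A))"
    using k by (intro Max_ge) auto
  finally show ?thesis using A pos by (simp add: growth_factor_def divide_right_mono)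
qed

lemma max_entry_pos:
  assumes B: "spectrum_within n m M B" and C: "spectrum_within n m' M' C" and n: "0 < n"
  shows "0 < max_entry (B + \<i> \<cdot>\<^sub>m C)"
proof -
  have Bc: "B \<in> carrier_mat n n" and Cc: "C \<in> carrier_mat n n"
    using B C by (auto simp: spectrum_within_def pos_def_def)
  have "0 < m" "0 < m'" using B C by (auto simp: spectrum_within_def)
  have "Re ((B + \<i> \<cdot>\<^sub>m C) $$ (0, 0)) = Re (B $$ (0, 0))"
    using Bc Cc n spectrum_within_entries(1)[OF C n n] by (simp add: complex_eq_iff)
  also have "\<dots> > 0" using spectrum_within_entries(2)[OF B n n] \<open>0 < m\<close> by simp
  finally have "0 < cmod ((B + \<i> \<cdot>\<^sub>m C) $$ (0, 0))" 
    using complex_Re_le_cmod order_less_le_trans by blast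
  also have "\<dots> \<le> max_entry (B + \<i> \<cdot>\<^sub>m C)"
    by (rule cmod_le_max_entry[of _ n n]) (use Bc Cc n in auto)
  finally show ?thesis .
qed

lemma cmod_ge_of_Re_Im:
  assumes "0 \<le> a" "a \<le> Re z" "0 \<le> b" "b \<le> Im z"
  shows "sqrt (a\<^sup>2 + b\<^sup>2) \<le> cmod z"
  unfolding cmod_def using assms by (intro real_sqrt_le_mono add_mono power_mono) auto

text \<open>Off the diagonal the triangle inequality is affordable, because the entries of \<open>B\<close> and \<open>C\<close>
  are at most \<open>M / 2\<close> and \<open>M' / 2\<close> there; on the diagonal they are real.\<close>
lemma max_entry_le_of_spectrum:
  assumes B: "spectrum_within n m M B" and C: "spectrum_within n m' M' C" and n: "0 < n"
  shows "max_entry (B + \<i> \<cdot>\<^sub>m C) \<le> sqrt (M\<^sup>2 + M'\<^sup>2)"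
proof (rule max_entry_le[OF _ n n])
  have Bc: "B \<in> carrier_mat n n" and Cc: "C \<in> carrier_mat n n"
    using B C by (auto simp: spectrum_within_def pos_def_def)
  have m: "0 < m" "0 < m'" using B C by (auto simp: spectrum_within_def)
  show "B + \<i> \<cdot>\<^sub>m C \<in> carrier_mat n n" using Bc Cc by simp
  fix i j assume ij: "i < n" "j < n"
  note b = spectrum_within_entries[OF B ij] and c = spectrum_within_entries[OF C ij]
  have entry: "(B + \<i> \<cdot>\<^sub>m C) $$ (i, j) = B $$ (i, j) + \<i> * C $$ (i, j)"
    using Bc Cc ij by simp
  show "cmod ((B + \<i> \<cdot>\<^sub>m C) $$ (i, j)) \<le> sqrt (M\<^sup>2 + M'\<^sup>2)"
  proof (cases "i = j")
    case True
    have "cmod ((B + \<i> \<cdot>\<^sub>m C) $$ (i, i)) = sqrt ((Re (B $$ (i, i)))\<^sup>2 + (Re (C $$ (i, i)))\<^sup>2)"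
      using entry True b(1) c(1) by (simp add: cmod_def complex_eq_iff)
    also have "\<dots> \<le> sqrt (M\<^sup>2 + M'\<^sup>2)"
      using b(2,3) c(2,3) m by (intro real_sqrt_le_mono add_mono power_mono) auto
    finally show ?thesis using True by simp
  next
    case False
    have "cmod ((B + \<i> \<cdot>\<^sub>m C) $$ (i, j)) \<le> cmod (B $$ (i, j)) + cmod (C $$ (i, j))"
      unfolding entry by (rule order_trans[OF norm_triangle_ineq]) (simp add: norm_mult)
    also have "\<dots> \<le> (M + M') / 2" using b(4) c(4) False by simp
    also have "\<dots> \<le> sqrt (M\<^sup>2 + M'\<^sup>2)"
    proof (rule real_le_rsqrt)
      have "((M + M') / 2)\<^sup>2 = (M\<^sup>2 + M'\<^sup>2) - (3 * M\<^sup>2 + 3 * M'\<^sup>2 - 2 * M * M') / 4"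
        by (simp add: power2_eq_square field_simps)
      also have "3 * M\<^sup>2 + 3 * M'\<^sup>2 - 2 * M * M' = 2 * M\<^sup>2 + 2 * M'\<^sup>2 + (M - M')\<^sup>2"
        by (simp add: power2_eq_square algebra_simps)
      also have "(M\<^sup>2 + M'\<^sup>2) - (2 * M\<^sup>2 + 2 * M'\<^sup>2 + (M - M')\<^sup>2) / 4 \<le> M\<^sup>2 + M'\<^sup>2"
        by simp
      finally show "((M + M') / 2)\<^sup>2 \<le> M\<^sup>2 + M'\<^sup>2" .
    qed
    finally show ?thesis .
  qed
qed

text \<open>Already the first entry after one elimination step is large enough: its real and imaginary
  part are at least \<open>m\<^sub>B\<close> and \<open>m\<^sub>C\<close>, and no entry of the original matrix exceeds
  \<open>\<omega>\<close> times the modulus of \<open>m\<^sub>B + \<i> m\<^sub>C\<close>.\<close>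
lemma growth_factor_lower:
  fixes \<omega> :: real
  assumes B: "spectrum_within n m\<^sub>B (\<omega> * m\<^sub>B) B" and C: "spectrum_within n m\<^sub>C (\<omega> * m\<^sub>C) C"
    and \<omega>: "1 \<le> \<omega>" and n: "2 \<le> n"
  shows "1 / \<omega> \<le> growth_factor (B + \<i> \<cdot>\<^sub>m C)"
proof -
  let ?A = "B + \<i> \<cdot>\<^sub>m C" and ?\<mu> = "sqrt (m\<^sub>B\<^sup>2 + m\<^sub>C\<^sup>2)"
  have m: "0 < m\<^sub>B" "0 < m\<^sub>C" using B C by (auto simp: spectrum_within_def)
  have A: "?A \<in> carrier_mat n n"
    using B C by (auto simp: spectrum_within_def pos_def_def)
  have \<mu>: "0 < ?\<mu>" using m by (simp add: add_pos_pos)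
  have pos: "0 < max_entry ?A" using max_entry_pos[OF B C] n by simp
  have "max_entry ?A \<le> sqrt ((\<omega> * m\<^sub>B)\<^sup>2 + (\<omega> * m\<^sub>C)\<^sup>2)"
    using max_entry_le_of_spectrum[OF B C] n by simp
  also have "\<dots> = \<omega> * ?\<mu>"
    using \<omega> by (simp add: power_mult_distrib real_sqrt_mult flip: distrib_left)
  finally have up: "max_entry ?A \<le> \<omega> * ?\<mu>" .
  let ?e = "unit_vec (n - 1) 0 :: complex vec" and ?S = "active_mat 1 ?A"
  have e: "?e \<in> carrier_vec (n - 1)" "l2norm_vec ?e = 1"
    using n by (auto simp: l2norm_vec_unit_vec)
  have "sesq ?S ?e ?e = ?S $$ (0, 0)"
    using n by (intro sesq_unit_vec[OF active_mat_carrier[OF A]]) auto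
  then have "?\<mu> \<le> cmod (?S $$ (0, 0))"
    using active_mat_form_bounds(1,2)[OF B C \<omega> _ e(1)] n e(2) m
    by (intro cmod_ge_of_Re_Im) auto
  then have "?\<mu> / (\<omega> * ?\<mu>) \<le> cmod (?S $$ (0, 0)) / max_entry ?A"
    using up pos \<mu> \<omega> by (intro frac_le) auto
  also have "\<dots> \<le> growth_factor ?A"
    using n by (intro growth_factor_ge[OF A _ _ _ _ pos]) auto
  finally show ?thesis using m by simp
qed

text \<open>The constant is \<open>sqrt 2 (1 + \<theta>\<^sup>2)\<close> with \<open>\<theta> = (\<omega> - 1) / (\<omega> + 1)\<close> from Wielandt's inequality;
  the factor \<open>sqrt 2\<close> comes from comparing \<open>Re + Im\<close> with the modulus.\<close>
lemma growth_factor_upper: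
  fixes \<omega> :: real
  assumes B: "spectrum_within n m\<^sub>B (\<omega> * m\<^sub>B) B" and C: "spectrum_within n m\<^sub>C (\<omega> * m\<^sub>C) C"
    and \<omega>: "1 \<le> \<omega>" and n: "2 \<le> n"
  shows "growth_factor (B + \<i> \<cdot>\<^sub>m C) \<le> 2 * sqrt 2 * (1 + \<omega>\<^sup>2) / (1 + \<omega>)\<^sup>2"
proof -
  let ?A = "B + \<i> \<cdot>\<^sub>m C"
  define K where "K = 1 + ((\<omega> - 1) / (\<omega> + 1))\<^sup>2"
  have K: "K = 2 * (1 + \<omega>\<^sup>2) / (1 + \<omega>)\<^sup>2"
  proof -
    have "(1 + \<omega>)\<^sup>2 \<noteq> 0" using \<omega> by simp
    then have "K = ((1 + \<omega>)\<^sup>2 + (\<omega> - 1)\<^sup>2) / (1 + \<omega>)\<^sup>2"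
      by (simp add: K_def power_divide add_divide_distrib add.commute)
    then show ?thesis by (simp add: power2_eq_square algebra_simps)
  qed
  have K0: "0 \<le> K" by (simp add: K_def)
  have m: "0 < m\<^sub>B" "0 < m\<^sub>C" using B C by (auto simp: spectrum_within_def)
  have Bc: "B \<in> carrier_mat n n" and Cc: "C \<in> carrier_mat n n"
    using B C by (auto simp: spectrum_within_def pos_def_def)
  then have A: "?A \<in> carrier_mat n n" by simp
  have pos: "0 < max_entry ?A" using max_entry_pos[OF B C] n by simp
  have "growth_factor ?A \<le> K * sqrt 2"
  proof (rule growth_factor_le[OF A n pos])
    fix k i j assume k: "1 \<le> k" "k < n" and ij: "i < n - k" "j < n - k"
    let ?S = "active_mat k ?A"
    have S: "?S \<in> carrier_mat (n - k) (n - k)" by (rule active_mat_carrier[OF A])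
    have kn: "k \<le> n" using k by simp
    note bounds = active_mat_form_bounds[OF B C \<omega> kn]
    have nn: "0 \<le> Re (sesq ?S e e) \<and> 0 \<le> Im (sesq ?S e e)" if "e \<in> carrier_vec (n - k)" for e
      using bounds(1,2)[OF that] m 
      by (meson mult_nonneg_nonneg order_trans less_imp_le zero_le_power2)
    have diag: "Re (?S $$ (t, t)) + Im (?S $$ (t, t)) \<le> K * (sqrt 2 * max_entry ?A)"
      if t: "t < n - k" for t
    proof -
      let ?e = "unit_vec (n - k) t :: complex vec"
      have E: "0\<^sub>v k @\<^sub>v ?e = unit_vec n (k + t)"
        using t k by (intro eq_vecI) auto
      have kt: "k + t < n" using t by simp
      have "Re (?S $$ (t, t)) + Im (?S $$ (t, t)) = Re (sesq ?S ?e ?e) + Im (sesq ?S ?e ?e)"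
        using sesq_unit_vec[OF S t t] by simp
      also have "\<dots> \<le> K * (Re (B $$ (k + t, k + t)) + Re (C $$ (k + t, k + t)))"
        using bounds(3)[of ?e] sesq_unit_vec[OF Bc kt kt] sesq_unit_vec[OF Cc kt kt]
        by (simp add: E K_def)
      also have "Re (B $$ (k + t, k + t)) + Re (C $$ (k + t, k + t))
          \<le> \<bar>Re (?A $$ (k + t, k + t))\<bar> + \<bar>Im (?A $$ (k + t, k + t))\<bar>"
        using Bc Cc kt spectrum_within_entries(1)[OF B kt kt] spectrum_within_entries(1)[OF C kt kt]
        by (simp add: complex_eq_iff)
      also have "\<dots> \<le> sqrt 2 * cmod (?A $$ (k + t, k + t))" by (rule complex_abs_le_norm)
      also have "\<dots> \<le> sqrt 2 * max_entry ?A"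
        using cmod_le_max_entry[OF A kt kt] by simp
      finally show ?thesis using K0 by (simp add: mult_left_mono)
    qed
    have "2 * cmod (?S $$ (i, j)) \<le> 2 * (K * (sqrt 2 * max_entry ?A))"
      using entry_le_of_accretive_form[OF S nn ij] diag[OF ij(1)] diag[OF ij(2)] by simp
    then show "cmod (?S $$ (i, j)) \<le> K * sqrt 2 * max_entry ?A" by (simp add: mult.assoc)
  qed
  then show ?thesis unfolding K by (simp add: algebra_simps)
qed

section \<open>Diagonal Higham matrices\<close>

text \<open>The ordered fields with conjugation do not come with a monotone product, so positivity of
  the diagonal entries is expressed by square roots \<open>s\<close>; it then reduces to that of \<open>x \<bullet>c x\<close>.\<close>
lemma pos_def_mat_diag:
  fixes d :: "nat \<Rightarrow> 'a :: conjugatable_ordered_field"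
  assumes d: "\<And>i. i < n \<Longrightarrow> d i = s i * conjugate (s i)" "\<And>i. i < n \<Longrightarrow> s i \<noteq> 0"
  shows "pos_def n (mat_diag n d)"
proof -
  have app: "mat_diag n f *\<^sub>v v = vec n (\<lambda>i. f i * v $ i)" if "v \<in> carrier_vec n" for f :: "nat \<Rightarrow> 'a" and v
    using that by (intro eq_vecI)
      (auto simp: mat_diag_def scalar_prod_def if_distrib[of "\<lambda>t. t * _"] sum.delta' cong: if_cong)
  have "mat_adjoint (mat_diag n d) = mat_diag n d"
    using d(1) by (intro eq_matI)
      (auto simp: mat_adjoint_def mat_of_rows_def mat_diag_def conjugate_dist_mul mult.commute)
  moreover have "0 < (mat_diag n d *\<^sub>v v) \<bullet>c v" if v: "v \<in> carrier_vec n" "v \<noteq> 0\<^sub>v n" for v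
  proof -
    let ?x = "vec n (\<lambda>i. s i * v $ i)"
    have "(mat_diag n d *\<^sub>v v) \<bullet>c v = ?x \<bullet>c ?x"
      unfolding app[OF v(1)] using v d(1)
      by (auto simp: scalar_prod_def conjugate_dist_mul mult_ac intro!: sum.cong)
    moreover have "?x \<noteq> 0\<^sub>v n"
    proof
      assume x: "?x = 0\<^sub>v n"
      have "v $ i = 0" if "i < n" for i
        using arg_cong[OF x, of "\<lambda>x. x $ i"] that d(2) by simp
      then show False using v by auto
    qed
    ultimately show ?thesis using conjugate_square_greater_0_vec[of ?x n] by simp
  qed
  ultimately show ?thesis by (auto simp: pos_def_def)
qed

lemma mat_inverse_mat_diag:
  fixes d :: "nat \<Rightarrow> complex"
  assumes "\<And>i. i < n \<Longrightarrow> d i \<noteq> 0"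
  shows "mat_inverse (mat_diag n d) = Some (mat_diag n (\<lambda>i. 1 / d i))"
proof -
  have id: "mat_diag n (\<lambda>i. f i) = 1\<^sub>m n" if "\<And>i. i < n \<Longrightarrow> f i = 1" for f :: "nat \<Rightarrow> complex"
    using that by (intro eq_matI) (auto simp: mat_diag_def)
  have l: "mat_diag n (\<lambda>i. 1 / d i) * mat_diag n d = 1\<^sub>m n"
   and r: "mat_diag n d * mat_diag n (\<lambda>i. 1 / d i) = 1\<^sub>m n"
    using assms by (simp_all add: mat_diag_diag id)
  have Dc: "mat_diag n d \<in> carrier_mat n n" "mat_diag n (\<lambda>i. 1 / d i) \<in> carrier_mat n n" by simp_all
  obtain X where X: "mat_inverse (mat_diag n d) = Some X" "X \<in> carrier_mat n n" "mat_diag n d * X = 1\<^sub>m n"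
  proof (rule mat_inverse_of_injective[OF Dc(1)])
    fix v :: "complex vec" assume v: "v \<in> carrier_vec n" "mat_diag n d *\<^sub>v v = 0\<^sub>v n"
    have "v = (mat_diag n (\<lambda>i. 1 / d i) * mat_diag n d) *\<^sub>v v" using l v by simp
    also have "\<dots> = 0\<^sub>v n"
      using assoc_mult_mat_vec[OF Dc(2) Dc(1) v(1)] v(2) mult_mat_zero_vec[OF Dc(2)] by simp
    finally show "v = 0\<^sub>v n" .
  qed
  have "X = (mat_diag n (\<lambda>i. 1 / d i) * mat_diag n d) * X" using l X by simp
  also have "\<dots> = mat_diag n (\<lambda>i. 1 / d i)"
    using assoc_mult_mat[OF Dc(2) Dc(1) X(2)] X(3) Dc by simp
  finally show ?thesis using X by simp
qed

lemma spectral_norm_mat_diag_le: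
  assumes n: "0 < n" and d: "\<And>i. i < n \<Longrightarrow> cmod (d i) \<le> c"
  shows "spectral_norm (mat_diag n d) \<le> c"
  unfolding spectral_norm_def
proof (rule cSUP_least)
  have "unit_vec n 0 \<in> {v \<in> carrier_vec (dim_col (mat_diag n d)). l2norm_vec v = 1}"
    using n by (simp add: l2norm_vec_unit_vec mat_diag_def)
  then show "{v \<in> carrier_vec (dim_col (mat_diag n d)). l2norm_vec v = 1} \<noteq> {}" by blast
  fix v assume "v \<in> {v \<in> carrier_vec (dim_col (mat_diag n d)). l2norm_vec v = 1}"
  then have v: "v \<in> carrier_vec n" "l2norm_vec v = 1" by (auto simp: mat_diag_def)
  have c: "0 \<le> c" using d[OF n] norm_ge_zero order_trans by blast
  have app: "mat_diag n d *\<^sub>v v = vec n (\<lambda>i. d i * v $ i)"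
    using v(1) by (intro eq_vecI)
      (auto simp: mat_diag_def scalar_prod_def if_distrib[of "\<lambda>t. t * _"] sum.delta' cong: if_cong)
  have "l2norm_vec (mat_diag n d *\<^sub>v v) \<le> sqrt (\<Sum>i<n. (c * cmod (v $ i))\<^sup>2)"
    unfolding app l2norm_vec_def
    by (auto simp: norm_mult intro!: sum_mono power_mono mult_right_mono d)
  also have "\<dots> = c * l2norm_vec v"
    using v(1) c by (simp add: l2norm_vec_def power_mult_distrib real_sqrt_mult flip: sum_distrib_left)
  finally show "l2norm_vec (mat_diag n d *\<^sub>v v) \<le> c" using v by simp
qed

lemma active_mat_mat_diag:
  fixes d :: "nat \<Rightarrow> complex"
  assumes d: "\<And>i. i < k \<Longrightarrow> d i \<noteq> 0" and k: "k \<le> n"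
  shows "active_mat k (mat_diag n d) = mat_diag (n - k) (\<lambda>i. d (i + k))"
proof -
  have sp: "split_block (mat_diag n d) k k =
      (mat_diag k d, 0\<^sub>m k (n - k), 0\<^sub>m (n - k) k, mat_diag (n - k) (\<lambda>i. d (i + k)))"
    using k unfolding split_block_def Let_def by (auto simp: mat_diag_def intro!: eq_matI)
  have "0\<^sub>m (n - k) k * mat_diag k (\<lambda>i. 1 / d i) * 0\<^sub>m k (n - k) = 0\<^sub>m (n - k) (n - k)"
    by (rule right_mult_zero_mat[of _ _ k]) (auto simp: mat_diag_def)
  then show ?thesis
    unfolding active_mat_def sp using mat_inverse_mat_diag[of k d] d
    by (auto simp: mat_diag_def intro!: eq_matI)
qed

text \<open>Elimination leaves a diagonal matrix unchanged apart from deleting its first entries. With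
  the large entry \<open>\<omega>\<close> in the first position, it is gone after one step.\<close>
lemma diagonal_higham_growth_factor_le:
  fixes \<omega> :: real and n :: nat
  assumes n: "2 \<le> n" and \<omega>: "1 \<le> \<omega>"
  defines "p \<equiv> \<lambda>i::nat. if i = 0 then \<omega> else 1"
  shows "growth_factor (mat_diag n (\<lambda>i. (1 + \<i>) * complex_of_real (p i))) \<le> 1 / \<omega>"
proof -
  let ?A = "mat_diag n (\<lambda>i. (1 + \<i>) * complex_of_real (p i))"
  have A: "?A \<in> carrier_mat n n" by simp
  have s2: "cmod (1 + \<i>) = sqrt 2" by (simp add: cmod_def)
  have nz: "1 + \<i> \<noteq> 0" using s2 by force
  have "cmod (?A $$ (0, 0)) \<le> max_entry ?A" using n by (intro cmod_le_max_entry[OF A]) auto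
  then have max: "sqrt 2 * \<omega> \<le> max_entry ?A"
    using n \<omega> by (simp add: mat_diag_def p_def norm_mult s2)
  show ?thesis
  proof (rule growth_factor_le[OF A n])
    show "0 < max_entry ?A" using max \<omega> by (smt (verit) mult_pos_pos real_sqrt_gt_zero)
    fix k i j assume k: "1 \<le> k" "k < n" "i < n - k" "j < n - k"
    have "active_mat k ?A = mat_diag (n - k) (\<lambda>i. (1 + \<i>) * complex_of_real (p (i + k)))"
      using k \<omega> nz by (intro active_mat_mat_diag) (auto simp: p_def)
    then have "cmod (active_mat k ?A $$ (i, j)) \<le> sqrt 2"
      using k by (auto simp: mat_diag_def p_def norm_mult s2)
    also have "\<dots> \<le> 1 / \<omega> * max_entry ?A"
      using max \<omega> by (simp add: field_simps)
    finally show "cmod (active_mat k ?A $$ (i, j)) \<le> 1 / \<omega> * max_entry ?A" .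
  qed
qed

section \<open>Bounds for the growth factor and their sharpness\<close>

theorem theorem1p5:
  fixes n :: nat
  assumes "n \<ge> 2"
  shows "(\<forall>(A :: complex mat) B C (\<omega> :: real).
            pos_def n B \<and> pos_def n C \<and> A = B + \<i> \<cdot>\<^sub>m C \<and>
            1 \<le> \<omega> \<and> max (cond_number B) (cond_number C) \<le> \<omega> \<longrightarrow>
            1 / \<omega> \<le> growth_factor A \<and>
            growth_factor A \<le> 2 * sqrt 2 * (1 + \<omega>\<^sup>2) / (1 + \<omega>)\<^sup>2)
       \<and> (\<forall>\<omega> :: real. 1 \<le> \<omega> \<longrightarrow>
            (\<exists>(A :: complex mat) B C (P :: real mat) (Q :: real mat).
               pos_def n P \<and> pos_def n Q \<and>
               B = map_mat complex_of_real P \<and> C = map_mat complex_of_real Q \<and>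
               A = B + \<i> \<cdot>\<^sub>m C \<and> diagonal_mat A \<and>
               max (cond_number B) (cond_number C) \<le> \<omega> \<and>
               growth_factor A = 1 / \<omega>))
       \<and> (\<forall>A \<in> accretive_dissipative n. growth_factor A < 2 * sqrt 2)"
proof -
  have bounds: "1 / \<omega> \<le> growth_factor (B + \<i> \<cdot>\<^sub>m C)"
    "growth_factor (B + \<i> \<cdot>\<^sub>m C) \<le> 2 * sqrt 2 * (1 + \<omega>\<^sup>2) / (1 + \<omega>)\<^sup>2"
    if BC: "pos_def n B" "pos_def n C" and \<omega>: "1 \<le> \<omega>"
      and cond: "cond_number B \<le> \<omega>" "cond_number C \<le> \<omega>" for B C \<omega>
  proof -
    have n: "0 < n" using assms by simp
    obtain m\<^sub>B where B: "spectrum_within n m\<^sub>B (\<omega> * m\<^sub>B) B"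
      by (rule pos_def_spectrum_within[OF BC(1) n cond(1)])
    obtain m\<^sub>C where C: "spectrum_within n m\<^sub>C (\<omega> * m\<^sub>C) C"
      by (rule pos_def_spectrum_within[OF BC(2) n cond(2)])
    show "1 / \<omega> \<le> growth_factor (B + \<i> \<cdot>\<^sub>m C)"
      by (rule growth_factor_lower[OF B C \<omega> assms])
    show "growth_factor (B + \<i> \<cdot>\<^sub>m C) \<le> 2 * sqrt 2 * (1 + \<omega>\<^sup>2) / (1 + \<omega>)\<^sup>2"
      by (rule growth_factor_upper[OF B C \<omega> assms])
  qed
  have sharp: "\<exists>(A :: complex mat) B C (P :: real mat) (Q :: real mat).
               pos_def n P \<and> pos_def n Q \<and>
               B = map_mat complex_of_real P \<and> C = map_mat complex_of_real Q \<and>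
               A = B + \<i> \<cdot>\<^sub>m C \<and> diagonal_mat A \<and>
               max (cond_number B) (cond_number C) \<le> \<omega> \<and>
               growth_factor A = 1 / \<omega>" if \<omega>: "1 \<le> \<omega>" for \<omega> :: real
  proof -
    define p :: "nat \<Rightarrow> real" where "p = (\<lambda>i. if i = 0 then \<omega> else 1)"
    have p: "1 \<le> p i" "p i \<le> \<omega>" for i using \<omega> by (auto simp: p_def)
    define P where "P = mat_diag n p"
    let ?B = "map_mat complex_of_real P"
    have B: "?B = mat_diag n (\<lambda>i. complex_of_real (p i))"
      unfolding P_def by (intro eq_matI) (auto simp: mat_diag_def)
    have A: "?B + \<i> \<cdot>\<^sub>m ?B = mat_diag n (\<lambda>i. (1 + \<i>) * complex_of_real (p i))"
      unfolding B by (intro eq_matI) (auto simp: mat_diag_def algebra_simps)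
    have p0: "0 < p i" for i using p(1)[of i] by simp
    have Ppd: "pos_def n P"
      unfolding P_def by (rule pos_def_mat_diag[where s = "\<lambda>i. sqrt (p i)"]) (use p0 in \<open>auto simp: less_imp_le order_less_imp_not_eq2\<close>)
    have Bpd: "pos_def n ?B"
      unfolding B by (rule pos_def_mat_diag[where s = "\<lambda>i. complex_of_real (sqrt (p i))"])
        (use p0 in \<open>auto simp: less_imp_le order_less_imp_not_eq2 simp flip: of_real_mult\<close>)
    have n: "0 < n" using assms by simp
    have "spectral_norm ?B \<le> \<omega>"
      unfolding B by (rule spectral_norm_mat_diag_le[OF n]) (use p p0 in \<open>auto simp: less_imp_le\<close>)
    moreover have "spectral_norm (the (mat_inverse ?B)) \<le> 1"
    proof -
      have "mat_inverse ?B = Some (mat_diag n (\<lambda>i. 1 / complex_of_real (p i)))"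
        unfolding B using p0 by (intro mat_inverse_mat_diag) (auto simp: order_less_imp_not_eq2)
      then show ?thesis
        using spectral_norm_mat_diag_le[OF n, of "\<lambda>i. 1 / complex_of_real (p i)" 1] p p0
        by (auto simp: norm_divide less_imp_le)
    qed
    moreover have "0 \<le> spectral_norm ?B"
      by (rule spectral_norm_nonneg[OF _ n]) (simp add: B)
    ultimately have cond: "cond_number ?B \<le> \<omega>"
      unfolding cond_number_def using \<omega> mult_mono[of "spectral_norm ?B" \<omega> "spectral_norm (the (mat_inverse ?B))" 1]
      by (smt (verit) mult_left_le)
    have "growth_factor (?B + \<i> \<cdot>\<^sub>m ?B) = 1 / \<omega>"
    proof (rule antisym)
      show "growth_factor (?B + \<i> \<cdot>\<^sub>m ?B) \<le> 1 / \<omega>"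
        unfolding A p_def by (rule diagonal_higham_growth_factor_le[OF assms \<omega>])
      show "1 / \<omega> \<le> growth_factor (?B + \<i> \<cdot>\<^sub>m ?B)"
        by (rule bounds(1)[OF Bpd Bpd \<omega> cond cond])
    qed
    moreover have "diagonal_mat (?B + \<i> \<cdot>\<^sub>m ?B)"
      unfolding A by (auto simp: diagonal_mat_def mat_diag_def)
    ultimately show ?thesis using Ppd cond by (metis max.idem)
  qed
  have strict: "growth_factor A < 2 * sqrt 2" if A: "A \<in> accretive_dissipative n" for A
  proof -
    obtain B C where BC: "A = B + \<i> \<cdot>\<^sub>m C" "pos_def n B" "pos_def n C"
      using A by (auto simp: accretive_dissipative_def)
    define \<omega> where "\<omega> = max 1 (max (cond_number B) (cond_number C))"
    have \<omega>: "1 \<le> \<omega>" "cond_number B \<le> \<omega>" "cond_number C \<le> \<omega>" by (auto simp: \<omega>_def)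
    have "growth_factor A \<le> 2 * sqrt 2 * (1 + \<omega>\<^sup>2) / (1 + \<omega>)\<^sup>2"
      unfolding BC(1) by (rule bounds(2)[OF BC(2,3) \<omega>])
    also have "\<dots> < 2 * sqrt 2"
    proof -
      have "1 + \<omega>\<^sup>2 < (1 + \<omega>)\<^sup>2" using \<omega>(1) by (simp add: power2_eq_square algebra_simps)
      then have "(1 + \<omega>\<^sup>2) / (1 + \<omega>)\<^sup>2 < 1" using \<omega>(1) by simp
      then have "2 * sqrt 2 * ((1 + \<omega>\<^sup>2) / (1 + \<omega>)\<^sup>2) < 2 * sqrt 2 * 1"
        by (intro mult_strict_left_mono) auto
      then show ?thesis by simp
    qed
    finally show ?thesis .
  qed
  show ?thesis using bounds sharp strict by auto
qed

end
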